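(* Let $d\ge 2$ be an integer and let $C:[0,1]^d\to[0,1]$ be a $d$-copula. Let $\Pi_d(u_1,\ldots,u_d)=u_1u_2\cdots u_d$ be the independence copula, and let $C^{(2)}$ and $C^{(3)}$ be the checkerboard approximations of $C$ of order $2$ and $3$, respectively. Then $C=\Pi_d$ if and only if $$C(u_1,\ldots,u_d)=C^{(2)}(u_1,\ldots,u_d)=C^{(3)}(u_1,\ldots,u_d)\quad\text{for all }(u_1,\ldots,u_d)\in[0,1]^d.$$
   Context: A $d$-copula is a function $C:[0,1]^d\to\mathbb{R}$ such that: (i) $C(u_1,\ldots,u_d)=0$ if at least one $u_i=0$; (ii) $C(1,\ldots,1,u_i,1,\ldots,1)=u_i$ for every $i\in\{1,\ldots,d\}$ and every $u_i\in[0,1]$; (iii) $C$ is $d$-increasing, i.e. for every box $B=[u_1,v_1]\times\cdots\times[u_d,v_d]\subseteq[0,1]^d$ (with $u_i\le v_i$), $V_C(B):=\sum_{b}\mathrm{sgn}(b)\,C(b)\ge 0$, where the sum runs over the vertices $b=(b_1,\ldots,b_d)$ of $B$, and $\mathrm{sgn}(b)=1$ if $b_k=u_k$ for an even number of $k$'s and $-1$ if $b_k=u_k$ for an odd number of $k$'s. Checkerboard approximation of order $m$: for a $d$-copula $C$ and an integer $m\ge 1$, $C^{(m)}:[0,1]^d\to[0,1]$ is the $d$-copula obtained by $d$-multilinear interpolation of the values of $C$ on the grid $\{0,1/m,\ldots,(m-1)/m,1\}^d$. That is, on each closed box $\prod_{j=1}^d[(i_j-1)/m,\,i_j/m]$,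 $i_1,\ldots,i_d\in\{1,\ldots,m\}$, $C^{(m)}$ is the unique function that is affine in each variable separately and agrees with $C$ at the $2^d$ vertices of the box. Equivalently, $C^{(m)}$ is the copula with density (with respect to Lebesgue measure) constant and equal to $m^d\,V_C\big(\prod_{j=1}^d[(i_j-1)/m,\,i_j/m]\big)$ on each such box. *)

theory Defs
  imports "HOL-Analysis.Analysis"
begin

abbreviation unit_cube :: "(real ^ 'd) set" where
  "unit_cube \<equiv> cbox 0 1"

definition upd :: "real ^ 'd \<Rightarrow> 'd \<Rightarrow> real \<Rightarrow> real ^ 'd" where
  "upd u j x = (\<chi> k. if k = j then x else u $ k)"

text \<open>The vertices are indexed by the set \<open>S\<close> of coordinates taken from the lower corner.
  On a degenerate box different sets give the same point, the sign of a vertex as a point is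
  ambiguous, and the sum over \<open>S\<close> is \<open>0\<close>.\<close>

definition box_volume :: "(real ^ 'd \<Rightarrow> real) \<Rightarrow> real ^ 'd \<Rightarrow> real ^ 'd \<Rightarrow> real" where
  "box_volume C u v =
     (\<Sum>S\<in>(UNIV :: 'd set set). (-1) ^ card S * C (\<chi> k. if k \<in> S then u $ k else v $ k))"

text \<open>Functions on the cube are total functions on \<open>real ^ 'd\<close>; values outside the cube are
  irrelevant.\<close>

definition copula :: "(real ^ 'd \<Rightarrow> real) \<Rightarrow> bool" where
  "copula C \<longleftrightarrow>
     (\<forall>u\<in>unit_cube. (\<exists>i. u $ i = 0) \<longrightarrow> C u = 0) \<and>
     (\<forall>i. \<forall>x\<in>{0..1}. C (upd 1 i x) = x) \<and>
     (\<forall>u\<in>unit_cube. \<forall>v\<in>unit_cube. (\<forall>i. u $ i \<le> v $ i) \<longrightarrow> box_volume C u v \<ge> 0)"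

definition indep_copula :: "real ^ 'd \<Rightarrow> real" where
  "indep_copula u = (\<Prod>i\<in>UNIV. u $ i)"

definition cell_lower :: "nat \<Rightarrow> ('d \<Rightarrow> nat) \<Rightarrow> real ^ 'd" where
  "cell_lower m i = (\<chi> j. (real (i j) - 1) / real m)"

definition cell_upper :: "nat \<Rightarrow> ('d \<Rightarrow> nat) \<Rightarrow> real ^ 'd" where
  "cell_upper m i = (\<chi> j. real (i j) / real m)"

definition box_vertices :: "real ^ 'd \<Rightarrow> real ^ 'd \<Rightarrow> (real ^ 'd) set" where
  "box_vertices a b = {w. \<forall>k. w $ k = a $ k \<or> w $ k = b $ k}"

definition separately_affine_on :: "(real ^ 'd) set \<Rightarrow> (real ^ 'd \<Rightarrow> real) \<Rightarrow> bool" where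
  "separately_affine_on B D \<longleftrightarrow>
     (\<forall>u\<in>B. \<forall>j. \<exists>p q. \<forall>x. upd u j x \<in> B \<longrightarrow> D (upd u j x) = p + q * x)"

definition is_checkerboard :: "nat \<Rightarrow> (real ^ 'd \<Rightarrow> real) \<Rightarrow> (real ^ 'd \<Rightarrow> real) \<Rightarrow> bool" where
  "is_checkerboard m C D \<longleftrightarrow>
     (\<forall>i. (\<forall>j. i j \<in> {1..m}) \<longrightarrow>
        separately_affine_on (cbox (cell_lower m i) (cell_upper m i)) D \<and>
        (\<forall>w\<in>box_vertices (cell_lower m i) (cell_upper m i). D w = C w))"

text \<open>The function is made unique by fixing it to be \<open>undefined\<close> outside the cube; existence and
  uniqueness are proved below.\<close>

definition checkerboard :: "nat \<Rightarrow> (real ^ 'd \<Rightarrow> real) \<Rightarrow> real ^ 'd \<Rightarrow> real" where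
  "checkerboard m C = (THE D. D \<in> extensional unit_cube \<and> is_checkerboard m C D)"

lemma upd_nth [simp]: "upd u j x $ k = (if k = j then x else u $ k)"
  by (simp add: upd_def)

lemma separately_affine_on_eq_0:
  fixes f :: "real ^ 'd \<Rightarrow> real"
  assumes aff: "separately_affine_on (cbox a b) f"
    and lt: "\<And>k. a $ k < b $ k"
    and zero: "\<And>w. w \<in> box_vertices a b \<Longrightarrow> f w = 0"
    and u: "u \<in> cbox a b"
  shows "f u = 0"
proof -
  have "\<forall>u\<in>cbox a b. (\<forall>k. k \<notin> K \<longrightarrow> u $ k = a $ k \<or> u $ k = b $ k) \<longrightarrow> f u = 0"
    if "finite K" for K :: "'d set"
    using that
  proof (induction K)
    case empty
    then show ?case using zero by (auto simp: box_vertices_def)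
  next
    case (insert j K)
    show ?case
    proof (intro ballI impI)
      fix u assume u: "u \<in> cbox a b"
        and v: "\<forall>k. k \<notin> insert j K \<longrightarrow> u $ k = a $ k \<or> u $ k = b $ k"
      obtain p q where pq: "\<And>x. upd u j x \<in> cbox a b \<Longrightarrow> f (upd u j x) = p + q * x"
        using aff u unfolding separately_affine_on_def by meson
      have mem: "upd u j x \<in> cbox a b" if "a $ j \<le> x" "x \<le> b $ j" for x
        using u that by (auto simp: mem_box_cart)
      have ma: "upd u j (a $ j) \<in> cbox a b" and mb: "upd u j (b $ j) \<in> cbox a b"
        using lt[of j] by (auto intro!: mem)
      have "f (upd u j (a $ j)) = 0" "f (upd u j (b $ j)) = 0"
        using insert.IH ma mb v by auto
      then have e: "p + q * a $ j = 0" "p + q * b $ j = 0"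
        using pq ma mb by auto
      then have "q * (b $ j - a $ j) = 0" unfolding right_diff_distrib by linarith
      then have "q = 0" using lt[of j] by simp
      moreover have "upd u j (u $ j) = u" by (simp add: vec_eq_iff)
      ultimately show "f u = 0" using pq[of "u $ j"] u e by simp
    qed
  qed
  from this[of UNIV] u show ?thesis by simp
qed

lemma separately_affine_on_diff:
  assumes "separately_affine_on B f" "separately_affine_on B g"
  shows "separately_affine_on B (\<lambda>u. f u - g u)"
  unfolding separately_affine_on_def
proof (intro ballI allI)
  fix u j assume "u \<in> B"
  then obtain p q p' q' where "\<And>x. upd u j x \<in> B \<Longrightarrow> f (upd u j x) = p + q * x"
    "\<And>x. upd u j x \<in> B \<Longrightarrow> g (upd u j x) = p' + q' * x"
    using assms unfolding separately_affine_on_def by meson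
  then have "\<forall>x. upd u j x \<in> B \<longrightarrow> f (upd u j x) - g (upd u j x) = (p - p') + (q - q') * x"
    by (simp add: algebra_simps)
  then show "\<exists>p q. \<forall>x. upd u j x \<in> B \<longrightarrow> f (upd u j x) - g (upd u j x) = p + q * x"
    by blast
qed

lemma unit_interval_in_cell:
  assumes "m \<ge> 1" "0 \<le> x" "x \<le> (1::real)"
  shows "\<exists>i\<in>{1..m}. (real i - 1) / real m \<le> x \<and> x \<le> real i / real m"
proof (cases "x = 0")
  case True
  then show ?thesis using assms by (intro bexI[of _ 1]) auto
next
  case False
  define i where "i = nat \<lceil>x * real m\<rceil>"
  have pos: "0 < x * real m" using False assms by simp
  then have i: "real i = of_int \<lceil>x * real m\<rceil>" by (simp add: i_def)
  have "x * real m \<le> real m" using assms by (simp add: mult_le_cancel_right1)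
  then have "i \<le> m" by (simp add: i_def ceiling_le_iff)
  moreover have "i \<ge> 1" using pos by (simp add: i_def Suc_le_eq)
  moreover have "real i - 1 \<le> x * real m" "x * real m \<le> real i"
    unfolding i by linarith+
  ultimately show ?thesis using assms by (intro bexI[of _ i]) (auto simp: field_simps)
qed

lemma unit_cube_in_cell:
  fixes u :: "real ^ 'd"
  assumes "m \<ge> 1" "u \<in> unit_cube"
  obtains i where "\<And>j. i j \<in> {1..m}" "u \<in> cbox (cell_lower m i) (cell_upper m i)"
proof -
  have "\<forall>j. \<exists>i\<in>{1..m}. (real i - 1) / real m \<le> u $ j \<and> u $ j \<le> real i / real m"
    using assms by (intro allI unit_interval_in_cell) (auto simp: mem_box_cart)
  then obtain i where "\<And>j. i j \<in> {1..m} \<and> (real (i j) - 1) / real m \<le> u $ j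
    \<and> u $ j \<le> real (i j) / real m" by metis
  then show thesis
    by (intro that[of i]) (auto simp: mem_box_cart cell_lower_def cell_upper_def)
qed

lemma cell_subset_unit_cube:
  assumes "m \<ge> 1" "\<And>j. i j \<in> {1..m}"
  shows "cbox (cell_lower m i) (cell_upper m i) \<subseteq> unit_cube"
proof
  fix u assume u: "u \<in> cbox (cell_lower m i) (cell_upper m i)"
  have "0 \<le> u $ j \<and> u $ j \<le> 1" for j
  proof -
    have "(real (i j) - 1) / real m \<le> u $ j" "u $ j \<le> real (i j) / real m"
      using u by (auto simp: mem_box_cart cell_lower_def cell_upper_def)
    moreover have "0 \<le> (real (i j) - 1) / real m" "real (i j) / real m \<le> 1"
      using assms(1) assms(2)[of j] by auto
    ultimately show ?thesis by linarith
  qed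
  then show "u \<in> unit_cube" by (simp add: mem_box_cart)
qed

lemma is_checkerboard_unique:
  assumes m: "m \<ge> 1" and D: "is_checkerboard m C D" and E: "is_checkerboard m C E"
    and u: "u \<in> unit_cube"
  shows "D u = E u"
proof -
  obtain i where i: "\<And>j. i j \<in> {1..m}" and ui: "u \<in> cbox (cell_lower m i) (cell_upper m i)"
    using unit_cube_in_cell[OF m u] by blast
  have "(\<lambda>u. D u - E u) u = 0"
  proof (rule separately_affine_on_eq_0[OF _ _ _ ui])
    show "separately_affine_on (cbox (cell_lower m i) (cell_upper m i)) (\<lambda>u. D u - E u)"
      using D E i unfolding is_checkerboard_def by (intro separately_affine_on_diff) auto
    show "cell_lower m i $ k < cell_upper m i $ k" for k
      using m by (simp add: cell_lower_def cell_upper_def divide_strict_right_mono)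
    show "D w - E w = 0" if "w \<in> box_vertices (cell_lower m i) (cell_upper m i)" for w
      using D E i that unfolding is_checkerboard_def by (metis diff_self)
  qed
  then show ?thesis by simp
qed

definition hat :: "real \<Rightarrow> real" where
  "hat x = max 0 (1 - \<bar>x\<bar>)"

definition hat_interpolant :: "nat \<Rightarrow> (real ^ 'd \<Rightarrow> real) \<Rightarrow> real ^ 'd \<Rightarrow> real" where
  "hat_interpolant m C u =
     (\<Sum>g\<in>{g. \<forall>j. g j \<le> m}. C (\<chi> j. real (g j) / real m) * (\<Prod>j\<in>UNIV. hat (real m * u $ j - real (g j))))"

lemma hat_int: "hat (of_int k) = (if k = 0 then 1 else 0)"
proof -
  have "\<bar>real_of_int k\<bar> \<ge> 1" if "k \<noteq> 0" using that by linarith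
  then show ?thesis by (auto simp: hat_def)
qed

lemma hat_nat_diff: "hat (real a - real b) = (if a = b then 1 else 0)"
  using hat_int[of "int a - int b"] by simp

lemma finite_grid: "finite {g :: 'd::finite \<Rightarrow> nat. \<forall>j. g j \<le> m}"
proof -
  have "{g :: 'd \<Rightarrow> nat. \<forall>j. g j \<le> m} = PiE UNIV (\<lambda>_. {..m})" by auto
  then show ?thesis by (simp add: finite_PiE)
qed

lemma hat_interpolant_grid:
  fixes C :: "real ^ 'd \<Rightarrow> real"
  assumes m: "m \<ge> 1" and h: "\<And>j. h j \<le> m"
  shows "hat_interpolant m C (\<chi> j. real (h j) / real m) = C (\<chi> j. real (h j) / real m)"
proof -
  have eq: "(\<Prod>j\<in>UNIV. hat (real m * (\<chi> j. real (h j) / real m) $ j - real (g j))) = (if g = h then 1 else 0)"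
    for g :: "'d \<Rightarrow> nat"
  proof -
    have "(\<Prod>j\<in>UNIV. hat (real m * (\<chi> j. real (h j) / real m) $ j - real (g j)))
        = (\<Prod>j\<in>UNIV. if h j = g j then 1 else 0)"
      using m by (simp add: hat_nat_diff)
    also have "\<dots> = (if g = h then 1 else 0)"
      by (auto simp: fun_eq_iff prod_zero_iff) metis
    finally show ?thesis .
  qed
  have "hat_interpolant m C (\<chi> j. real (h j) / real m) =
      (\<Sum>g\<in>{g. \<forall>j. g j \<le> m}. if g = h then C (\<chi> j. real (g j) / real m) else 0)"
    unfolding hat_interpolant_def eq by (intro sum.cong) auto
  then show ?thesis
    using h by (simp add: finite_grid)
qed

lemma hat_affine:
  assumes m: "m \<ge> 1"
  obtains p q where "\<And>x. (real i - 1) / real m \<le> x \<Longrightarrow> x \<le> real i / real m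
    \<Longrightarrow> hat (real m * x - real g) = p + q * x"
proof -
  have r: "real i - 1 \<le> real m * x" "real m * x \<le> real i"
    if "(real i - 1) / real m \<le> x" "x \<le> real i / real m" for x
    using that m by (auto simp: field_simps)
  consider "g = i" | "g + 1 = i" | "g \<ge> i + 1" | "g + 2 \<le> i" by linarith
  then show thesis
  proof cases
    case 1
    show thesis
      by (rule that[of "1 - real g" "real m"]) (use r 1 in \<open>force simp: hat_def\<close>)
  next
    case 2
    show thesis
      by (rule that[of "1 + real g" "- real m"]) (use r 2 in \<open>force simp: hat_def\<close>)
  next
    case 3
    show thesis
      by (rule that[of 0 0]) (use r 3 in \<open>force simp: hat_def\<close>)
  next
    case 4
    show thesis
      by (rule that[of 0 0]) (use r 4 in \<open>force simp: hat_def\<close>)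
  qed
qed

lemma hat_interpolant_affine:
  fixes C :: "real ^ 'd \<Rightarrow> real"
  assumes m: "m \<ge> 1"
  shows "separately_affine_on (cbox (cell_lower m i) (cell_upper m i)) (hat_interpolant m C)"
  unfolding separately_affine_on_def
proof (intro ballI allI)
  fix u :: "real ^ 'd" and j :: 'd
  let ?B = "cbox (cell_lower m i) (cell_upper m i)"
  have "\<forall>g :: nat. \<exists>pq. \<forall>x. (real (i j) - 1) / real m \<le> x \<longrightarrow> x \<le> real (i j) / real m
      \<longrightarrow> hat (real m * x - real g) = fst pq + snd pq * x"
    by (metis hat_affine[OF m] fst_conv snd_conv)
  then obtain pq where pq: "\<And>g x. (real (i j) - 1) / real m \<le> x \<Longrightarrow> x \<le> real (i j) / real m
      \<Longrightarrow> hat (real m * x - real g) = fst (pq g) + snd (pq g) * x"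
    by metis
  define R where "R g = C (\<chi> j. real (g j) / real m) *
      (\<Prod>k\<in>UNIV - {j}. hat (real m * u $ k - real (g k)))" for g :: "'d \<Rightarrow> nat"
  have "hat_interpolant m C (upd u j x) =
      (\<Sum>g\<in>{g. \<forall>j. g j \<le> m}. R g * fst (pq (g j))) + (\<Sum>g\<in>{g. \<forall>j. g j \<le> m}. R g * snd (pq (g j))) * x"
    if "upd u j x \<in> ?B" for x
  proof -
    have x: "(real (i j) - 1) / real m \<le> x" "x \<le> real (i j) / real m"
      using that by (auto simp: mem_box_cart cell_lower_def cell_upper_def dest!: spec[of _ j])
    have "(\<Prod>k\<in>UNIV. hat (real m * upd u j x $ k - real (g k)))
        = (fst (pq (g j)) + snd (pq (g j)) * x) * (\<Prod>k\<in>UNIV - {j}. hat (real m * u $ k - real (g k)))"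
      for g
      by (subst prod.remove[of _ j]) (auto simp: pq[OF x] intro!: prod.cong)
    then show ?thesis
      by (simp add: hat_interpolant_def R_def sum_distrib_right sum_distrib_left sum.distrib[symmetric] algebra_simps
          del: upd_nth)
  qed
  then show "\<exists>p q. \<forall>x. upd u j x \<in> ?B \<longrightarrow> hat_interpolant m C (upd u j x) = p + q * x"
    by blast
qed

lemma is_checkerboard_hat_interpolant:
  fixes C :: "real ^ 'd \<Rightarrow> real"
  assumes m: "m \<ge> 1"
  shows "is_checkerboard m C (hat_interpolant m C)"
  unfolding is_checkerboard_def
proof (intro allI impI conjI ballI hat_interpolant_affine[OF m])
  fix i :: "'d \<Rightarrow> nat" and w
  assume i: "\<forall>j. i j \<in> {1..m}" and w: "w \<in> box_vertices (cell_lower m i) (cell_upper m i)"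
  define h where "h j = (if w $ j = real (i j) / real m then i j else i j - 1)" for j
  have "w $ j = real (h j) / real m" for j
  proof -
    have "real (i j - 1) = real (i j) - 1" using i[rule_format, of j] by simp
    then show ?thesis
      using w by (auto simp: h_def box_vertices_def cell_lower_def cell_upper_def dest!: spec[of _ j])
  qed
  then have "w = (\<chi> j. real (h j) / real m)" by (simp add: vec_eq_iff)
  moreover have "h j \<le> m" for j using i[rule_format, of j] by (auto simp: h_def)
  ultimately show "hat_interpolant m C w = C w"
    using hat_interpolant_grid[OF m, of h C] by simp
qed

lemma is_checkerboard_cong:
  assumes m: "m \<ge> 1" and D: "is_checkerboard m C D"
    and eq: "\<And>u. u \<in> unit_cube \<Longrightarrow> D u = E u"
  shows "is_checkerboard m C E"
  unfolding is_checkerboard_def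
proof (intro allI impI)
  fix i :: "'a \<Rightarrow> nat" assume i: "\<forall>j. i j \<in> {1..m}"
  let ?B = "cbox (cell_lower m i) (cell_upper m i)"
  have sub: "?B \<subseteq> unit_cube" using cell_subset_unit_cube[OF m] i by blast
  have "cell_lower m i $ k \<le> cell_upper m i $ k" for k
    using m by (simp add: cell_lower_def cell_upper_def divide_right_mono)
  then have "box_vertices (cell_lower m i) (cell_upper m i) \<subseteq> ?B"
    by (auto simp: box_vertices_def mem_box_cart) (metis order_refl)+
  moreover have "E u = D u" if "u \<in> ?B" for u using eq sub that by auto
  ultimately show "separately_affine_on ?B E \<and>
      (\<forall>w\<in>box_vertices (cell_lower m i) (cell_upper m i). E w = C w)"
    using D i unfolding is_checkerboard_def separately_affine_on_def
    by (simp add: subset_iff)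
qed

theorem ex1_checkerboard:
  assumes m: "m \<ge> 1"
  shows "\<exists>!D. D \<in> extensional unit_cube \<and> is_checkerboard m C D"
proof (rule ex1I)
  let ?D = "restrict (hat_interpolant m C) unit_cube"
  show "?D \<in> extensional unit_cube \<and> is_checkerboard m C ?D"
    using is_checkerboard_cong[OF m is_checkerboard_hat_interpolant[OF m], of C ?D] by simp
  fix D assume D: "D \<in> extensional unit_cube \<and> is_checkerboard m C D"
  then show "D = ?D"
    using is_checkerboard_unique[OF m _ is_checkerboard_hat_interpolant[OF m], of C D]
    by (intro extensionalityI[where A = unit_cube]) auto
qed

lemma is_checkerboard_checkerboard:
  assumes "m \<ge> 1"
  shows "is_checkerboard m C (checkerboard m C)"
  using theI'[OF ex1_checkerboard[OF assms, of C]] unfolding checkerboard_def by blast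

lemma checkerboard_eqI:
  assumes "m \<ge> 1" "is_checkerboard m C D" "u \<in> unit_cube"
  shows "checkerboard m C u = D u"
  using is_checkerboard_unique[OF assms(1) is_checkerboard_checkerboard[OF assms(1)] assms(2,3)] .

end

theory Submission
  imports Defs
begin

text \<open>
  On every axis-parallel segment, the checkerboard approximation of order \<open>m\<close> is piecewise affine,
  with kinks only at the multiples of \<open>1/m\<close>. If \<open>C\<close> equals both its approximations of order 2 and
  3, then its restriction to such a segment can have a kink only at a point of
  \<open>{1/2} \<inter> {1/3, 2/3} = {}\<close>, so \<open>C\<close> is affine in each variable on the whole cube
  (\<open>separately_affine_on_unit_cube_if_checkerboards\<close>). A separately affine function is determined by
  its values at the vertices of the cube, and every copula has the same vertex values as the
  independence copula: 1 at \<open>(1, \<dots>, 1)\<close> and 0 elsewhere.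

  The converse holds because the product of the coordinates is itself separately affine, so it is
  the multilinear interpolation of its own values on every grid.
\<close>

definition affine_on :: "real set \<Rightarrow> (real \<Rightarrow> real) \<Rightarrow> bool" where
  "affine_on A f \<longleftrightarrow> (\<exists>p q. \<forall>x\<in>A. f x = p + q * x)"

text \<open>Two affine pieces that share an interval of positive length share two points, and so have
  the same coefficients.\<close>

lemma affine_on_overlapping_intervals:
  assumes f: "affine_on {a..c} f" "affine_on {b..d} f"
    and ord: "a \<le> b" "b < c" "c \<le> d"
  shows "affine_on {a..d} f"
proof -
  obtain p q where pq: "\<And>x. x \<in> {a..c} \<Longrightarrow> f x = p + q * x"
    using f(1) by (auto simp: affine_on_def)
  obtain r s where rs: "\<And>x. x \<in> {b..d} \<Longrightarrow> f x = r + s * x"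
    using f(2) by (auto simp: affine_on_def)
  have b: "p + q * b = r + s * b" and c: "p + q * c = r + s * c"
    using pq[of b] rs[of b] pq[of c] rs[of c] ord by auto
  have "(q - s) * (c - b) = 0" using b c by (simp add: algebra_simps)
  then have "q = s" using ord by simp
  moreover from this b have "p = r" by simp
  ultimately have "f x = p + q * x" if "x \<in> {a..d}" for x
    using pq[of x] rs[of x] that ord by (cases "x \<le> c") auto
  then show ?thesis unfolding affine_on_def by blast
qed

lemma is_checkerboard_self:
  assumes "m \<ge> 1" and "\<And>u. u \<in> unit_cube \<Longrightarrow> checkerboard m C u = C u"
  shows "is_checkerboard m C C"
  using is_checkerboard_cong[OF assms(1) is_checkerboard_checkerboard[OF assms(1)] assms(2)] .

lemma is_checkerboard_affine_on_segment:
  fixes D :: "real ^ 'd \<Rightarrow> real"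
  assumes m: "m \<ge> 1" and D: "is_checkerboard m C D"
    and u: "u \<in> unit_cube" and k: "k \<in> {1..m}"
  shows "affine_on {(real k - 1) / real m .. real k / real m} (\<lambda>x. D (upd u j x))"
proof -
  obtain i where i: "\<And>l. i l \<in> {1..m}" and ui: "u \<in> cbox (cell_lower m i) (cell_upper m i)"
    using unit_cube_in_cell[OF m u] by blast
  \<comment> \<open>Moving along coordinate \<open>j\<close> changes only the \<open>j\<close>-th index of the cell.\<close>
  define i' where "i' = i(j := k)"
  define B where "B = cbox (cell_lower m i') (cell_upper m i')"
  have mem: "upd u j x \<in> B" if "x \<in> {(real k - 1) / real m .. real k / real m}" for x
    using ui that
    by (auto simp: B_def i'_def mem_box_cart cell_lower_def cell_upper_def)
  have aff: "separately_affine_on B D"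
    using D i k unfolding is_checkerboard_def B_def i'_def by simp
  have "(real k - 1) / real m \<le> real k / real m" by (simp add: divide_right_mono)
  then have "upd u j (real k / real m) \<in> B" by (intro mem) auto
  then obtain p q where
    "\<And>x. upd (upd u j (real k / real m)) j x \<in> B \<Longrightarrow>
       D (upd (upd u j (real k / real m)) j x) = p + q * x"
    using aff unfolding separately_affine_on_def by meson
  moreover have "upd (upd u j y) j x = upd u j x" for x y by (simp add: vec_eq_iff)
  ultimately show ?thesis using mem unfolding affine_on_def by auto
qed

text \<open>The middle third bridges the two halves: its interior contains \<open>1/2\<close>, the only kink that order 2
  leaves possible.\<close>

lemma separately_affine_on_unit_cube_if_checkerboards:
  fixes C :: "real ^ 'd \<Rightarrow> real"
  assumes C2: "is_checkerboard 2 C C" and C3: "is_checkerboard 3 C C"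
  shows "separately_affine_on unit_cube C"
  unfolding separately_affine_on_def
proof (intro ballI allI)
  fix u :: "real ^ 'd" and j assume u: "u \<in> unit_cube"
  let ?f = "\<lambda>x. C (upd u j x)"
  have left: "affine_on {0..1/2} ?f" and right: "affine_on {1/2..1} ?f"
    using is_checkerboard_affine_on_segment[OF _ C2 u, of 1 j]
      is_checkerboard_affine_on_segment[OF _ C2 u, of 2 j] by simp_all
  have mid: "affine_on {1/3..2/3} ?f"
    using is_checkerboard_affine_on_segment[OF _ C3 u, of 2 j] by simp
  have "affine_on {0..2/3} ?f"
    using left mid by (rule affine_on_overlapping_intervals) simp_all
  then have "affine_on {0..1} ?f"
    using right by (rule affine_on_overlapping_intervals) simp_all
  then obtain p q where pq: "\<And>x. x \<in> {0..1} \<Longrightarrow> ?f x = p + q * x"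
    unfolding affine_on_def by blast
  have "x \<in> {0..1}" if "upd u j x \<in> unit_cube" for x
    using that by (auto simp: mem_box_cart dest: spec[of _ j])
  then show "\<exists>p q. \<forall>x. upd u j x \<in> unit_cube \<longrightarrow> ?f x = p + q * x"
    using pq by blast
qed

lemma separately_affine_on_indep_copula:
  fixes B :: "(real ^ 'd) set"
  shows "separately_affine_on B indep_copula"
  unfolding separately_affine_on_def
proof (intro ballI allI)
  fix u :: "real ^ 'd" and j
  have "indep_copula (upd u j x) = 0 + (\<Prod>k\<in>UNIV - {j}. u $ k) * x" for x
    unfolding indep_copula_def by (subst prod.remove[of _ j]) auto
  then show "\<exists>p q. \<forall>x. upd u j x \<in> B \<longrightarrow> indep_copula (upd u j x) = p + q * x" by blast
qed

lemma is_checkerboard_indep_copula: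
  "is_checkerboard m indep_copula indep_copula"
  by (simp add: is_checkerboard_def separately_affine_on_indep_copula)

lemma copula_eq_indep_copula_at_vertices:
  fixes C :: "real ^ 'd \<Rightarrow> real"
  assumes C: "copula C" and w: "w \<in> box_vertices 0 1"
  shows "C w = indep_copula w"
proof (cases "\<exists>i. w $ i = 0")
  case True
  have "\<And>k. w $ k = 0 \<or> w $ k = 1" using w by (simp add: box_vertices_def)
  then have "w \<in> unit_cube"
    by (auto simp: mem_box_cart) (metis order_refl zero_le_one)+
  then have "C w = 0" using C True by (simp add: copula_def)
  moreover have "indep_copula w = 0" using True by (simp add: indep_copula_def)
  ultimately show ?thesis by simp
next
  case False
  then have w1: "w = 1" using w by (auto simp: box_vertices_def vec_eq_iff)
  have "\<forall>i. C (upd 1 i 1) = 1" using C by (simp add: copula_def)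
  moreover have "upd 1 i 1 = (1 :: real ^ 'd)" for i by (simp add: vec_eq_iff)
  ultimately show ?thesis by (simp add: w1 indep_copula_def)
qed

lemma separately_affine_copula_eq_indep_copula:
  assumes "copula C" and "separately_affine_on unit_cube C" and "u \<in> unit_cube"
  shows "C u = indep_copula u"
proof -
  have "C u - indep_copula u = 0"
    by (rule separately_affine_on_eq_0[of 0 1 "\<lambda>u. C u - indep_copula u"])
      (use assms in \<open>simp_all add: copula_eq_indep_copula_at_vertices
        separately_affine_on_diff separately_affine_on_indep_copula\<close>)
  then show ?thesis by simp
qed

lemma checkerboard_eq_if_eq_indep_copula:
  fixes C :: "real ^ 'd \<Rightarrow> real"
  assumes m: "m \<ge> 1" and eq: "\<And>u. u \<in> unit_cube \<Longrightarrow> C u = indep_copula u"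
    and u: "u \<in> unit_cube"
  shows "checkerboard m C u = C u"
proof -
  have "w \<in> unit_cube"
    if i: "\<forall>j. i j \<in> {1..m}" and w: "w \<in> box_vertices (cell_lower m i) (cell_upper m i)"
    for i and w :: "real ^ 'd"
  proof -
    have "cell_lower m i $ k \<le> cell_upper m i $ k" for k
      by (simp add: cell_lower_def cell_upper_def divide_right_mono)
    then have "w \<in> cbox (cell_lower m i) (cell_upper m i)"
      using w by (auto simp: box_vertices_def mem_box_cart) (metis order_refl)+
    then show ?thesis using cell_subset_unit_cube[OF m, of i] i by blast
  qed
  then have "is_checkerboard m C indep_copula"
    using is_checkerboard_indep_copula eq unfolding is_checkerboard_def by metis
  then show ?thesis using checkerboard_eqI[OF m _ u] eq[OF u] by metis
qed

theorem theorem2p4: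
  fixes C :: "real ^ 'd \<Rightarrow> real"
  assumes "CARD('d) \<ge> 2"
    and "copula C"
    and "C \<in> unit_cube \<rightarrow> {0..1}"
  shows "(\<forall>u\<in>unit_cube. C u = indep_copula u) \<longleftrightarrow>
    (\<forall>u\<in>unit_cube. C u = checkerboard 2 C u \<and> checkerboard 2 C u = checkerboard 3 C u)"
proof
  assume "\<forall>u\<in>unit_cube. C u = indep_copula u"
  then have "checkerboard m C u = C u" if "m \<ge> 1" "u \<in> unit_cube" for m u
    using that by (intro checkerboard_eq_if_eq_indep_copula) auto
  then show "\<forall>u\<in>unit_cube. C u = checkerboard 2 C u \<and> checkerboard 2 C u = checkerboard 3 C u"
    by simp
next
  assume "\<forall>u\<in>unit_cube. C u = checkerboard 2 C u \<and> checkerboard 2 C u = checkerboard 3 C u"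
  then have "is_checkerboard 2 C C" "is_checkerboard 3 C C"
    by (auto intro!: is_checkerboard_self)
  then have "separately_affine_on unit_cube C"
    by (rule separately_affine_on_unit_cube_if_checkerboards)
  then show "\<forall>u\<in>unit_cube. C u = indep_copula u"
    using separately_affine_copula_eq_indep_copula[OF assms(2)] by blast
qed

end
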